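(* For every prime $p$, $t(3p)=3p-3$.
   Context: For a positive integer $n$ let $S(\mathbb{Z}_n)$ be the set of bijections $\mathbb{Z}_n\to\mathbb{Z}_n$. For $\pi\in S(\mathbb{Z}_n)$, $\mathrm{cyc}(\pi)$ is the number of cycles (including fixed points) of $\pi$ and $t(\pi)=n-\mathrm{cyc}(\pi)$. Let $[\pi]=\{x\mapsto \pi(x+b): b\in\mathbb{Z}_n\}$, $t([\pi])=\min_{\sigma\in[\pi]}t(\sigma)$, and $t(n)=\max_{\pi\in S(\mathbb{Z}_n)}t([\pi])$. *)

theory Defs
  imports "HOL-Combinatorics.Combinatorics" "HOL-Computational_Algebra.Primes"
begin

text \<open>Z_n is modelled as {..<n} (residues 0..n-1); bijections of Z_n are
  permutations of {..<n} (identity outside).\<close>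

definition cyc :: "nat \<Rightarrow> (nat \<Rightarrow> nat) \<Rightarrow> nat" where
  "cyc n \<sigma> = card ((\<lambda>x. orbit \<sigma> x) ` {..<n})"

definition tperm :: "nat \<Rightarrow> (nat \<Rightarrow> nat) \<Rightarrow> nat" where
  "tperm n \<sigma> = n - cyc n \<sigma>"

definition shiftp :: "nat \<Rightarrow> (nat \<Rightarrow> nat) \<Rightarrow> nat \<Rightarrow> (nat \<Rightarrow> nat)" where
  "shiftp n \<pi> b = (\<lambda>x. if x < n then \<pi> ((x + b) mod n) else x)"

definition tclass :: "nat \<Rightarrow> (nat \<Rightarrow> nat) \<Rightarrow> nat" where
  "tclass n \<pi> = Min ((\<lambda>b. tperm n (shiftp n \<pi> b)) ` {..<n})"

definition tmax :: "nat \<Rightarrow> nat" where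
  "tmax n = Max ((\<lambda>\<pi>. tclass n \<pi>) ` {\<pi>. \<pi> permutes {..<n}})"

end

theory Submission
  imports Defs "HOL-Number_Theory.Number_Theory"
begin

text \<open>
  Let \<open>n = 3 p\<close> and \<open>\<phi> = \<pi>\<^sup>-\<^sup>1\<close>. If every shift of \<open>\<pi>\<close> had at most two cycles, then no shift could
  have two fixed points, so \<open>\<phi> x - x\<close> would be a bijection and every shift would consist of one
  fixed point and one cycle of length \<open>n - 1 > 2\<close>. No shift would then contain a transposition, so
  \<open>\<phi> x + x\<close> would be a bijection as well, and \<open>\<phi>\<close> would be a solution of the toroidal queens
  problem, which does not exist when \<open>3\<close> divides \<open>n\<close>.

  Conversely, for \<open>p \<ge> 5\<close> identify residues modulo \<open>3 p\<close> with pairs of residues modulo \<open>3\<close> and \<open>p\<close>,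
  let \<open>g\<close> be a primitive root modulo \<open>p\<close>, and take \<open>\<pi> (u, x) = (c x - u, g x)\<close>. All shifts of \<open>\<pi>\<close>
  have three cycles provided that the convolution of \<open>c\<close> with the quadratic character modulo \<open>p\<close>
  has no zero modulo \<open>3\<close>, and \<open>c\<close> can be taken to be a sum of one or two translates of that
  character. The cases \<open>p = 2, 3\<close> are settled by explicit permutations.
\<close>

section \<open>Some shift has at least three cycles\<close>

lemma shiftp_permutes:
  assumes "\<pi> permutes {..<n}"
  shows "shiftp n \<pi> b permutes {..<n}"
proof (rule bij_imp_permutes)
  have "inj_on (\<lambda>x. (x + b) mod n) {..<n}"
  proof (rule inj_onI)
    fix x y assume "x \<in> {..<n}" "y \<in> {..<n}" "(x + b) mod n = (y + b) mod n"
    then have "[x + b = y + b] (mod n)" by (simp add: cong_def)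
    then show "x = y"
      using \<open>x \<in> _\<close> \<open>y \<in> _\<close> by (simp add: cong_add_rcancel_nat cong_less_modulus_unique_nat)
  qed
  then have "inj_on (\<lambda>x. \<pi> ((x + b) mod n)) {..<n}"
    using inj_on_subset[OF permutes_inj[OF assms] subset_UNIV] by (rule comp_inj_on[unfolded comp_def])
  then have "inj_on (shiftp n \<pi> b) {..<n}"
    by (rule inj_on_cong[THEN iffD1, rotated]) (simp add: shiftp_def)
  moreover have "shiftp n \<pi> b ` {..<n} \<subseteq> {..<n}"
  proof (rule image_subsetI)
    fix x assume "x \<in> {..<n}"
    then have "(x + b) mod n \<in> {..<n}" by simp
    then have "\<pi> ((x + b) mod n) \<in> {..<n}" using permutes_in_image[OF assms] by blast
    then show "shiftp n \<pi> b x \<in> {..<n}" using \<open>x \<in> {..<n}\<close> by (simp add: shiftp_def)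
  qed
  ultimately show "bij_betw (shiftp n \<pi> b) {..<n} {..<n}"
    by (simp add: bij_betw_def endo_inj_surj)
qed (simp add: shiftp_def)

lemma orbit_funpow_eq:
  assumes "permutation f"
  shows "orbit f ((f ^^ k) x) = orbit f x"
proof (induction k)
  case (Suc k)
  then show ?case
    using self_in_orbit_step[OF permutation_self_in_orbit[OF assms]] by simp
qed simp

text \<open>Moving along a cycle does not change the orbit, so \<open>R\<close> meets every orbit.
  All upper bounds on cycle counts come from such lists of representatives.\<close>

lemma cyc_le_card:
  assumes "\<sigma> permutes {..<n}" "finite R" "\<And>x. x < n \<Longrightarrow> \<exists>k. (\<sigma> ^^ k) x \<in> R"
  shows "cyc n \<sigma> \<le> card R"
proof -
  have "permutation \<sigma>" using permutes_imp_permutation[OF _ assms(1)] by simp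
  then have "orbit \<sigma> ` {..<n} \<subseteq> orbit \<sigma> ` R"
    using assms(3) by clarsimp (metis image_iff orbit_funpow_eq)
  then show ?thesis
    unfolding cyc_def using \<open>finite R\<close> by (meson card_image_le card_mono finite_imageI le_trans)
qed

lemma card_le_cyc:
  assumes "R \<subseteq> {..<n}" "inj_on (orbit \<sigma>) R"
  shows "card R \<le> cyc n \<sigma>"
  unfolding cyc_def using assms by (metis card_image card_mono finite_imageI finite_lessThan image_mono)

section \<open>Sums of squares and the toroidal queens obstruction\<close>

lemma sum_squares_inj_mod:
  fixes f :: "nat \<Rightarrow> int"
  assumes "n > 0" "inj_on (\<lambda>x. f x mod int n) {..<n}"
  shows "[(\<Sum>x<n. (f x)\<^sup>2) = (\<Sum>x<n. (int x)\<^sup>2)] (mod int n)"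
proof -
  define h where "h = (\<lambda>x. nat (f x mod int n))"
  have h: "int (h x) = f x mod int n" for x using assms(1) by (simp add: h_def)
  have "inj_on h {..<n}"
    using assms(2) h unfolding inj_on_def by metis
  moreover have "h ` {..<n} \<subseteq> {..<n}" using assms(1)
    by (auto simp: h_def nat_less_iff)
  ultimately have "bij_betw h {..<n} {..<n}" by (simp add: bij_betw_def endo_inj_surj)
  then have "(\<Sum>x<n. (int x)\<^sup>2) = (\<Sum>x<n. (int (h x))\<^sup>2)"
    by (rule sum.reindex_bij_betw[symmetric])
  moreover have "[(\<Sum>x<n. (f x)\<^sup>2) = (\<Sum>x<n. (int (h x))\<^sup>2)] (mod int n)"
    by (intro cong_sum cong_pow) (simp add: h)
  ultimately show ?thesis by simp
qed

lemma six_sum_squares: "6 * (\<Sum>x<n. (int x)\<^sup>2) = int n * ((int n - 1) * (2 * int n - 1))"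
  by (induction n) (auto simp: algebra_simps power2_eq_square)

text \<open>
  If \<open>\<phi>\<close>, \<open>\<phi> x - x\<close> and \<open>\<phi> x + x\<close> all run through the residues, then summing
  \<open>(\<phi> x - x)\<^sup>2 + (\<phi> x + x)\<^sup>2 = 2 (\<phi> x)\<^sup>2 + 2 x\<^sup>2\<close> shows that \<open>n\<close> divides twice the sum of squares.
\<close>
lemma no_modular_queens:
  fixes \<phi> :: "nat \<Rightarrow> int"
  assumes "n > 0" "3 dvd n"
    and "inj_on (\<lambda>x. \<phi> x mod int n) {..<n}"
    and "inj_on (\<lambda>x. (\<phi> x - int x) mod int n) {..<n}"
    and "inj_on (\<lambda>x. (\<phi> x + int x) mod int n) {..<n}"
  shows False
proof -
  define S where "S = (\<Sum>x<n. (int x)\<^sup>2)"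
  have "[S + S = (\<Sum>x<n. (\<phi> x - int x)\<^sup>2) + (\<Sum>x<n. (\<phi> x + int x)\<^sup>2)] (mod int n)"
    unfolding S_def by (intro cong_add cong_sym[OF sum_squares_inj_mod] assms)
  also have "(\<Sum>x<n. (\<phi> x - int x)\<^sup>2) + (\<Sum>x<n. (\<phi> x + int x)\<^sup>2) = 2 * (\<Sum>x<n. (\<phi> x)\<^sup>2) + 2 * S"
    unfolding S_def sum_distrib_left sum.distrib[symmetric]
    by (intro sum.cong) (auto simp: algebra_simps power2_eq_square)
  also have "[2 * (\<Sum>x<n. (\<phi> x)\<^sup>2) + 2 * S = 2 * S + 2 * S] (mod int n)"
    unfolding S_def by (intro cong_add cong_mult cong_refl sum_squares_inj_mod assms)
  finally have "int n dvd 2 * S" by (simp add: cong_iff_dvd_diff)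
  \<comment> \<open>The factor 3 produces \<open>6 * S\<close>, whose closed form contains the
    factor \<open>n\<close>; cancelling \<open>n\<close> leaves a divisibility by 3.\<close>
  then have "int n * 3 dvd 3 * (2 * S)" by (metis mult.commute mult_dvd_mono dvd_refl)
  also have "3 * (2 * S) = int n * ((int n - 1) * (2 * int n - 1))"
    using six_sum_squares[of n] by (simp add: S_def)
  finally have "3 dvd (int n - 1) * (2 * int n - 1)" using assms(1) by simp
  moreover obtain m where "n = 3 * m" using assms(2) by blast
  ultimately have "3 dvd (3 * int m - 1) * (6 * int m - 1)" by simp
  also have "(3 * int m - 1) * (6 * int m - 1) = 3 * (6 * int m * int m - 3 * int m) + 1"
    by (simp add: algebra_simps)
  finally show False by presburger
qed

text \<open>The shift by \<open>\<phi> x - y\<close> sends \<open>y\<close> to \<open>x\<close>.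
  Hence a coincidence among the \<open>\<phi> x - x\<close> gives a shift with two fixed points, and
  one among the \<open>\<phi> x + x\<close> a shift swapping two points. Both lead to three
  cycles.\<close>

lemma exists_shift_three_cycles:
  assumes \<pi>: "\<pi> permutes {..<n}" and n: "3 dvd n" "n > 3"
  shows "\<exists>b<n. 3 \<le> cyc n (shiftp n \<pi> b)"
proof (rule ccontr)
  assume neg: "\<not> ?thesis"
  define \<phi> where "\<phi> x = int (inv_into UNIV \<pi> x)" for x
  have \<phi>_less: "inv_into UNIV \<pi> x < n" if "x < n" for x
    using permutes_in_image[OF permutes_inv[OF \<pi>], of x] that by simp
  have few: False if "b < n" "R \<subseteq> {..<n}" "card R = 3" "inj_on (orbit (shiftp n \<pi> b)) R" for b R
    using card_le_cyc[OF that(2,4)] that(1,3) neg by auto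
  have self: "x \<in> orbit (shiftp n \<pi> b) x" for b x
    by (intro permutation_self_in_orbit permutes_imp_permutation[OF _ shiftp_permutes[OF \<pi>]]) simp
  have move: "shiftp n \<pi> (nat ((\<phi> x - int y) mod int n)) y = x" if "x < n" "y < n" for x y
  proof -
    have "int ((y + nat ((\<phi> x - int y) mod int n)) mod n) = (int y + (\<phi> x - int y)) mod int n"
      using n by (simp add: zmod_int mod_simps)
    also have "\<dots> = int (inv_into UNIV \<pi> x)" using \<phi>_less[OF that(1)] by (simp add: \<phi>_def)
    finally show ?thesis
      using that permutes_inverses(1)[OF \<pi>] by (simp add: shiftp_def)
  qed
  have less: "nat (z mod int n) < n" for z using n by (simp add: nat_less_iff)
  have inj_diff: "inj_on (\<lambda>x. (\<phi> x - int x) mod int n) {..<n}"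
  proof (rule inj_onI, rule ccontr)
    fix x y assume xy: "x \<in> {..<n}" "y \<in> {..<n}"
      "(\<phi> x - int x) mod int n = (\<phi> y - int y) mod int n" "x \<noteq> y"
    define b where "b = nat ((\<phi> x - int x) mod int n)"
    have "shiftp n \<pi> b x = x" "shiftp n \<pi> b y = y"
      using move[of x x] move[of y y] xy by (auto simp: b_def)
    then have orb: "orbit (shiftp n \<pi> b) x = {x}" "orbit (shiftp n \<pi> b) y = {y}"
      by (simp_all add: orbit_eq_singleton_iff)
    \<comment> \<open>Any point besides the two fixed ones lies on a third cycle.\<close>
    have "card ({..<n} - {x, y}) > 0"
      using n xy by (subst card_Diff_subset) auto
    then obtain z where z: "z < n" "z \<noteq> x" "z \<noteq> y"
      by (auto simp: card_gt_0_iff)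
    have "inj_on (orbit (shiftp n \<pi> b)) {x, y, z}"
      using orb self[of z b] xy z by auto
    then show False using few[of b "{x, y, z}"] xy z less by (auto simp: b_def)
  qed
  moreover have "inj_on (\<lambda>x. (\<phi> x + int x) mod int n) {..<n}"
  proof (rule inj_onI, rule ccontr)
    fix x y assume xy: "x \<in> {..<n}" "y \<in> {..<n}"
      "(\<phi> x + int x) mod int n = (\<phi> y + int y) mod int n" "x \<noteq> y"
    define b where "b = nat ((\<phi> x - int y) mod int n)"
    have "(\<phi> x - int y) mod int n = (\<phi> y - int x) mod int n"
      using xy(3) by (simp add: mod_eq_dvd_iff algebra_simps)
    then have swap: "shiftp n \<pi> b y = x" "shiftp n \<pi> b x = y"
      using move[of x y] move[of y x] xy by (auto simp: b_def)
    \<comment> \<open>Injectivity of the differences makes them surjective, so the shift by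
      \<open>b\<close> also has a fixed point \<open>f\<close>. As \<open>n > 3\<close>, a point
      outside the swapped pair and \<open>f\<close> gives a third cycle.\<close>
    have "(\<lambda>x. nat ((\<phi> x - int x) mod int n)) ` {..<n} = {..<n}"
    proof (rule endo_inj_surj)
      show "inj_on (\<lambda>x. nat ((\<phi> x - int x) mod int n)) {..<n}"
        using inj_diff n by (auto simp: inj_on_def nat_eq_iff)
    qed (use less in auto)
    moreover have "b < n" using less by (simp add: b_def)
    ultimately obtain f where f: "f < n" "b = nat ((\<phi> f - int f) mod int n)" by auto
    then have fixed: "shiftp n \<pi> b f = f" using move[of f f] by simp
    have "card ({..<n} - {x, y, f}) > 0"
      using n xy f fixed swap by (subst card_Diff_subset) (auto simp: card_insert_if)
    then obtain z where z: "z < n" "z \<noteq> x" "z \<noteq> y" "z \<noteq> f"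
      by (auto simp: card_gt_0_iff)
    have "w \<in> {x, y}" if "w \<in> orbit (shiftp n \<pi> b) x" for w
      using that by induction (auto simp: swap)
    then have "orbit (shiftp n \<pi> b) x \<subseteq> {x, y}" by blast
    moreover have "orbit (shiftp n \<pi> b) f = {f}" using fixed by (simp add: orbit_eq_singleton_iff)
    moreover have "f \<noteq> x" "f \<noteq> y" using fixed swap xy by auto
    ultimately have "inj_on (orbit (shiftp n \<pi> b)) {x, f, z}"
      using self[of z b] self[of x b] z by auto
    then show False using few[of b "{x, f, z}"] xy z f \<open>b < n\<close> \<open>f \<noteq> x\<close> by auto
  qed
  moreover have "inj_on (\<lambda>x. \<phi> x mod int n) {..<n}"
    using permutes_inj[OF permutes_inv[OF \<pi>]] \<phi>_less by (auto simp: inj_on_def \<phi>_def)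
  ultimately show False using no_modular_queens[of n \<phi>] n by auto
qed

text \<open>Within a class the minimum of \<open>tperm\<close> is attained at a shift with the most
  cycles. One such shift in each class bounds \<open>tmax\<close> from above, and
  \<open>\<pi>\<close> attains the bound.\<close>

lemma tmax_eqI:
  assumes "n > 0"
    and "\<And>\<pi>. \<pi> permutes {..<n} \<Longrightarrow> \<exists>b<n. k \<le> cyc n (shiftp n \<pi> b)"
    and "\<pi> permutes {..<n}" "\<And>b. b < n \<Longrightarrow> cyc n (shiftp n \<pi> b) \<le> k"
  shows "tmax n = n - k"
proof -
  have le: "tclass n \<rho> \<le> n - k" if \<rho>: "\<rho> permutes {..<n}" for \<rho>
  proof -
    obtain b where "b < n" "k \<le> cyc n (shiftp n \<rho> b)" using assms(2)[OF \<rho>] by blast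
    then have "tclass n \<rho> \<le> tperm n (shiftp n \<rho> b)" "tperm n (shiftp n \<rho> b) \<le> n - k"
      unfolding tclass_def by (auto intro!: Min_le simp: tperm_def)
    then show ?thesis by simp
  qed
  have "n - k \<le> tclass n \<pi>"
    unfolding tclass_def using assms(1,4) by (subst Min_ge_iff) (auto simp: tperm_def diff_le_mono2)
  then have "tclass n \<pi> = n - k" using le[OF assms(3)] by simp
  then show ?thesis
    unfolding tmax_def using le assms(3) finite_permutations[of "{..<n}"]
    by (intro Max_eqI) (auto intro: image_eqI[OF sym])
qed

section \<open>Explicit permutations modulo 6 and 9\<close>

lemma permutes_of_list:
  assumes "distinct xs" "set xs \<subseteq> {..<length xs}"
  shows "(\<lambda>x. if x < length xs then xs ! x else x) permutes {..<length xs}"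
proof (rule bij_imp_permutes)
  have "set xs = {..<length xs}"
    using assms by (intro card_subset_eq) (auto simp: distinct_card)
  then have "bij_betw ((!) xs) {..<length xs} {..<length xs}"
    using assms(1) by (intro bij_betw_nth) auto
  then show "bij_betw (\<lambda>x. if x < length xs then xs ! x else x) {..<length xs} {..<length xs}"
    by (rule bij_betw_cong[THEN iffD1, rotated]) simp
qed simp

text \<open>\<open>rs ! b\<close> holds representatives of the cycles of the shift by
  \<open>b\<close>. Quantifiers over explicit lists let the hypothesis be checked by evaluation;
  exponents below \<open>n\<close> suffice because no cycle is longer than \<open>n\<close>.\<close>

lemma cyc_shiftp_nth_le:
  fixes xs :: "nat list" and rs :: "nat list list"
  assumes n: "length xs = n" and "distinct xs" "set xs \<subseteq> {..<n}"
    and rs: "\<forall>b\<in>set [0..<n]. length (rs ! b) \<le> m \<and> (\<forall>x\<in>set [0..<n]. \<exists>k\<in>set [0..<n].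
      ((\<lambda>x. xs ! ((x + b) mod n)) ^^ k) x \<in> set (rs ! b))"
  shows "\<exists>\<pi>. \<pi> permutes {..<n} \<and> (\<forall>b<n. cyc n (shiftp n \<pi> b) \<le> m)"
proof (intro exI conjI allI impI)
  let ?\<pi> = "\<lambda>x. if x < n then xs ! x else x"
  show \<pi>: "?\<pi> permutes {..<n}" using permutes_of_list[of xs] assms by simp
  fix b assume b: "b < n"
  let ?\<tau> = "\<lambda>x. xs ! ((x + b) mod n)"
  have eq: "(shiftp n ?\<pi> b ^^ k) x = (?\<tau> ^^ k) x \<and> (?\<tau> ^^ k) x < n" if "x < n" for x k
  proof (induction k)
    case (Suc k)
    have "xs ! ((y + b) mod n) < n" if "y < n" for y
      using assms(3) b nth_mem[of "(y + b) mod n" xs] n by (auto simp del: nth_mem)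
    then show ?case using Suc by (simp add: shiftp_def)
  qed (use that in simp)
  have "\<exists>k. (shiftp n ?\<pi> b ^^ k) x \<in> set (rs ! b)" if x: "x < n" for x
  proof -
    obtain k where "(?\<tau> ^^ k) x \<in> set (rs ! b)" using rs b x by fastforce
    then show ?thesis using eq[OF x] by auto
  qed
  then have "cyc n (shiftp n ?\<pi> b) \<le> card (set (rs ! b))"
    by (intro cyc_le_card shiftp_permutes \<pi>) auto
  also have "\<dots> \<le> length (rs ! b)" by (rule card_length)
  also have "\<dots> \<le> m" using rs b by simp
  finally show "cyc n (shiftp n ?\<pi> b) \<le> m" .
qed

lemma shifts_mod_6_le_three_cycles: "\<exists>\<pi>. \<pi> permutes {..<6::nat} \<and> (\<forall>b<6. cyc 6 (shiftp 6 \<pi> b) \<le> 3)"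
proof -
  \<comment> \<open>Doubling modulo 5 on the residues below 5, with 5 fixed.\<close>
  let ?xs = "[0, 2, 4, 1, 3, 5] :: nat list"
  let ?rs = "[[0, 1, 5], [0, 3], [0, 1, 2], [0, 2], [0, 1, 4], [0, 2]] :: nat list list"
  have "\<forall>b\<in>set [0..<6]. length (?rs ! b) \<le> 3 \<and>
    (\<forall>x\<in>set [0..<6]. \<exists>k\<in>set [0..<6].
      ((\<lambda>x. ?xs ! ((x + b) mod 6)) ^^ k) x \<in> set (?rs ! b))"
    by code_simp
  then show ?thesis by (rule cyc_shiftp_nth_le[rotated 3]) auto
qed

lemma shifts_mod_9_le_three_cycles: "\<exists>\<pi>. \<pi> permutes {..<9::nat} \<and> (\<forall>b<9. cyc 9 (shiftp 9 \<pi> b) \<le> 3)"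
proof -
  let ?xs = "[0, 1, 3, 4, 6, 2, 8, 5, 7] :: nat list"
  \<comment> \<open>The shifts by 4, 5 and 6 are single cycles of length 9.\<close>
  let ?rs = "[[0, 1, 2], [0, 2, 7], [0, 1, 5],
    [0, 2, 3], [0], [0], [0], [0, 6, 8], [0, 3, 4]] :: nat list list"
  have "\<forall>b\<in>set [0..<9]. length (?rs ! b) \<le> 3 \<and>
    (\<forall>x\<in>set [0..<9]. \<exists>k\<in>set [0..<9].
      ((\<lambda>x. ?xs ! ((x + b) mod 9)) ^^ k) x \<in> set (?rs ! b))"
    by code_simp
  then show ?thesis by (rule cyc_shiftp_nth_le[rotated 3]) auto
qed

section \<open>Correlations of the Legendre symbol\<close>

lemma Legendre_cong:
  assumes "[a = b] (mod p)"
  shows "Legendre a p = Legendre b p"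
proof -
  have "[y\<^sup>2 = a] (mod p) \<longleftrightarrow> [y\<^sup>2 = b] (mod p)" for y
    using assms cong_sym cong_trans by blast
  moreover have "[a = 0] (mod p) \<longleftrightarrow> [b = 0] (mod p)"
    using assms cong_sym cong_trans by blast
  ultimately show ?thesis by (simp add: Legendre_def QuadRes_def)
qed

text \<open>Euler's criterion gives the identity modulo \<open>p\<close>; the two sides differ by at
  most 2, which is less than \<open>p\<close>.\<close>

lemma Legendre_mult:
  assumes "prime p" "2 < p"
  shows "Legendre (a * b) (int p) = Legendre a p * Legendre b p"
proof -
  have "[Legendre (a * b) p = (a * b) ^ ((p - 1) div 2)] (mod int p)"
    by (rule euler_criterion) fact+
  also have "[(a * b) ^ ((p - 1) div 2) = Legendre a p * Legendre b p] (mod int p)"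
    unfolding power_mult_distrib
    by (intro cong_mult cong_sym[OF euler_criterion] assms)
  finally have "int p dvd Legendre (a * b) p - Legendre a p * Legendre b p"
    by (simp add: cong_iff_dvd_diff)
  moreover have "\<bar>Legendre (a * b) p\<bar> \<le> 1" "\<bar>Legendre a p * Legendre b p\<bar> \<le> 1"
    by (simp_all add: Legendre_def)
  ultimately show ?thesis
    using assms(2) dvd_imp_le_int[of "Legendre (a * b) p - Legendre a p * Legendre b p" "int p"]
    by fastforce
qed

lemma Legendre_square:
  assumes "\<not> [a = 0] (mod p)"
  shows "Legendre a p * Legendre a p = 1"
  using assms by (simp add: Legendre_def)

text \<open>By Euler's criterion, the value 1 would force the order \<open>p - 1\<close> of
  \<open>g\<close> to divide \<open>(p - 1) div 2\<close>.\<close>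

lemma Legendre_primroot:
  assumes "prime p" "2 < p" "residue_primroot p g"
  shows "Legendre (int g) (int p) = -1"
proof -
  have cop: "coprime p g" and ord: "ord p g = p - 1"
    using assms by (auto simp: residue_primroot_def totient_prime)
  have "\<not> [int g = 0] (mod int p)"
    using cop assms(1) by (metis cong_0_iff coprime_absorb_left int_dvd_int_iff not_prime_unit)
  moreover have "Legendre (int g) p \<noteq> 1"
  proof
    assume "Legendre (int g) p = 1"
    then have "[int g ^ ((p - 1) div 2) = 1] (mod int p)"
      using euler_criterion[OF assms(1,2), of "int g"] by (simp add: cong_sym)
    then have "[g ^ ((p - 1) div 2) = 1] (mod p)"
      by (metis cong_int_iff of_nat_1 of_nat_power)
    then have "p - 1 dvd (p - 1) div 2" using ord by (simp add: ord_divides')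
    then show False using assms(2) by (auto dest!: dvd_imp_le)
  qed
  ultimately show ?thesis by (auto simp: Legendre_def split: if_splits)
qed

lemma sum_affine_mod:
  fixes F :: "int \<Rightarrow> int"
  assumes per: "\<And>x y. [x = y] (mod int p) \<Longrightarrow> F x = F y" and "p > 0" "coprime a (int p)"
  shows "(\<Sum>y<p. F (a * int y + b)) = (\<Sum>y<p. F (int y))"
proof -
  define h where "h y = nat ((a * int y + b) mod int p)" for y
  have h: "int (h y) = (a * int y + b) mod int p" for y using assms(2) by (simp add: h_def)
  have "inj_on h {..<p}"
  proof (rule inj_onI)
    fix x y assume xy: "x \<in> {..<p}" "y \<in> {..<p}" "h x = h y"
    then have "[a * int x + b = a * int y + b] (mod int p)" by (simp add: cong_def flip: h)
    then have "[int x = int y] (mod int p)"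
      using assms(3) by (simp add: cong_add_rcancel cong_mult_lcancel)
    then show "x = y" using xy by (simp add: cong_int_iff cong_less_modulus_unique_nat)
  qed
  moreover have "h ` {..<p} \<subseteq> {..<p}" using assms(2) by (auto simp: h_def nat_less_iff)
  ultimately have "bij_betw h {..<p} {..<p}" by (simp add: bij_betw_def endo_inj_surj)
  then have "(\<Sum>y<p. F (int y)) = (\<Sum>y<p. F (int (h y)))" by (rule sum.reindex_bij_betw[symmetric])
  also have "\<dots> = (\<Sum>y<p. F (a * int y + b))"
    by (intro sum.cong refl per) (simp add: h)
  finally show ?thesis ..
qed

context
  fixes p :: nat
  assumes p: "prime p" "2 < p"
begin

text \<open>Multiplication by a primitive root permutes the residues and flips the sign of the
  symbol, so the sum equals its own negative.\<close>

lemma sum_Legendre: "(\<Sum>y<p. Legendre (int y + b) (int p)) = 0"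
proof -
  obtain g where g: "residue_primroot p g" using prime_primitive_root_exists[of p] p by auto
  have "coprime (int g) (int p)"
    using g by (simp add: residue_primroot_def coprime_commute)
  then have "(\<Sum>y<p. Legendre (int g * int y + 0) (int p)) = (\<Sum>y<p. Legendre (int y) (int p))"
    using p by (intro sum_affine_mod Legendre_cong) auto
  then have "(\<Sum>y<p. Legendre (int y) (int p)) = 0"
    using Legendre_primroot[OF p g] by (simp add: Legendre_mult[OF p] sum_negf)
  then show ?thesis
    using sum_affine_mod[of p "\<lambda>x. Legendre x (int p)" 1 b] p Legendre_cong by simp
qed

lemma sum_Legendre_square: "(\<Sum>y<p. Legendre (int y) (int p) * Legendre (int y) (int p)) = int p - 1"
proof -
  have "(\<Sum>y<p. Legendre (int y) (int p) * Legendre (int y) (int p)) = (\<Sum>y\<in>{..<p} - {0}. 1)"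
    using p by (intro sum.mono_neutral_cong_right ballI)
      (auto simp: Legendre_def cong_0_iff dest: nat_dvd_not_less)
  then show ?thesis using p by (simp add: of_nat_diff)
qed

text \<open>For \<open>m\<close> prime to \<open>p\<close>, replacing \<open>y\<close> by
  \<open>m * y\<close> pulls out the square of \<open>Legendre m p\<close>, so the correlation does
  not depend on such \<open>m\<close>. Its value follows because the correlations over all
  \<open>m\<close> add up to 0.\<close>

lemma sum_Legendre_shift:
  "(\<Sum>y<p. Legendre (int y) (int p) * Legendre (int y + m) (int p)) =
    (if int p dvd m then int p - 1 else -1)"
proof (cases "int p dvd m")
  case True
  then have "Legendre (int y + m) (int p) = Legendre (int y) (int p)" for y
    by (intro Legendre_cong) (simp add: cong_iff_dvd_diff)
  then show ?thesis using True sum_Legendre_square by simp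
next
  case False
  define J where "J m = (\<Sum>y<p. Legendre (int y) (int p) * Legendre (int y + m) (int p))" for m
  have J: "J m = J 1" if m: "\<not> int p dvd m" for m
  proof -
    have "coprime m (int p)" using m p prime_imp_coprime[of "int p" m] by (simp add: coprime_commute)
    then have "J m = (\<Sum>y<p. Legendre (m * int y + 0) (int p) * Legendre (m * int y + 0 + m) (int p))"
      unfolding J_def using p
      by (intro sum_affine_mod[symmetric] arg_cong2[of _ _ _ _ "(*)"] Legendre_cong cong_add) auto
    also have "\<dots> = (\<Sum>y<p. Legendre m p * Legendre m p * (Legendre y p * Legendre (int y + 1) p))"
    proof (intro sum.cong refl)
      fix y
      have "m * int y + 0 + m = m * (int y + 1)" by (simp add: algebra_simps)
      then show "Legendre (m * int y + 0) (int p) * Legendre (m * int y + 0 + m) (int p) =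
        Legendre m p * Legendre m p * (Legendre y p * Legendre (int y + 1) p)"
        by (simp add: Legendre_mult[OF p])
    qed
    finally show ?thesis using m by (simp add: Legendre_square cong_0_iff J_def)
  qed
  have "0 = (\<Sum>y<p. Legendre (int y) (int p) * (\<Sum>m<p. Legendre (int m + int y) (int p)))"
    by (simp add: sum_Legendre)
  also have "\<dots> = (\<Sum>m<p. J (int m))"
    unfolding J_def sum_distrib_left by (subst sum.swap) (simp add: add.commute)
  also have "\<dots> = J 0 + (\<Sum>m\<in>{..<p} - {0}. J (int m))"
    using p by (subst sum.remove[of _ 0]) auto
  also have "(\<Sum>m\<in>{..<p} - {0}. J (int m)) = (\<Sum>m\<in>{..<p} - {0}. J 1)"
    by (intro sum.cong refl J) (auto dest: nat_dvd_not_less)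
  also have "\<dots> = (int p - 1) * J 1" using p by (simp add: of_nat_diff)
  also have "J 0 = int p - 1" using sum_Legendre_square by (simp add: J_def)
  finally have "(int p - 1) * (1 + J 1) = 0" by (simp add: distrib_left)
  then have "J 1 = -1" using p by auto
  then show ?thesis using False J[OF False] by (simp add: J_def)
qed

end

section \<open>A permutation modulo three times a prime\<close>

text \<open>The powers of \<open>g\<close> run through the nonzero residues, with symbols
  \<open>(-1) ^ k\<close>. This turns the alternating sum picked up along a long cycle into a
  correlation with the quadratic character.\<close>

lemma sum_primroot_powers:
  fixes c :: "int \<Rightarrow> int"
  assumes p: "prime p" "2 < p" "residue_primroot p g"
    and c: "\<And>x y. [x = y] (mod int p) \<Longrightarrow> c x = c y"
  shows "(\<Sum>k<p - 1. (-1) ^ k * c (e + int g ^ k)) = (\<Sum>y<p. Legendre (int y) (int p) * c (e + int y))"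
proof -
  have tot: "totient p = p - 1" "totatives p = {..<p} - {0}"
    using p(1) prime_gt_1_nat[OF p(1)] by (auto simp: totient_prime totatives_prime)
  have bij: "bij_betw (\<lambda>k. g ^ k mod p) {..<p - 1} ({..<p} - {0})"
    using residue_primroot_is_generator[OF _ p(3)] p(2) tot by simp
  have pow: "Legendre (int g ^ k) (int p) = (-1) ^ k" for k
  proof (induction k)
    case 0
    have "QuadRes (int p) 1" unfolding QuadRes_def by (rule exI[of _ 1]) simp
    then show ?case using p(2) by (simp add: Legendre_def cong_def)
  qed (simp add: Legendre_mult[OF p(1,2)] Legendre_primroot[OF p])
  have "(\<Sum>y<p. Legendre (int y) (int p) * c (e + int y)) =
      (\<Sum>y\<in>{..<p} - {0}. Legendre (int y) (int p) * c (e + int y))"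
    by (intro sum.mono_neutral_right) (auto simp: Legendre_def)
  also have "\<dots> = (\<Sum>k<p - 1. Legendre (int (g ^ k mod p)) (int p) * c (e + int (g ^ k mod p)))"
    by (rule sum.reindex_bij_betw[OF bij, symmetric])
  also have "\<dots> = (\<Sum>k<p - 1. (-1) ^ k * c (e + int g ^ k))"
  proof (intro sum.cong refl)
    fix k
    have *: "[int (g ^ k mod p) = int g ^ k] (mod int p)" by (simp add: zmod_int cong_def)
    have "Legendre (int (g ^ k mod p)) (int p) = (-1) ^ k"
        "c (e + int (g ^ k mod p)) = c (e + int g ^ k)"
      using Legendre_cong[OF *] pow by (auto intro!: c cong_add *)
    then show "Legendre (int (g ^ k mod p)) (int p) * c (e + int (g ^ k mod p)) =
        (-1) ^ k * c (e + int g ^ k)"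
      by simp
  qed
  finally show ?thesis ..
qed

text \<open>
  Over the field of three elements, the convolution of the quadratic character with itself is a
  combination of the delta function at zero and a constant, so one or two translates of the
  character suffice to make the convolution with it nowhere zero.
\<close>
definition twist :: "nat \<Rightarrow> int \<Rightarrow> int" where
  "twist p y = Legendre y p + (if p mod 3 = 1 then Legendre (y - 1) p else 0)"

lemma twist_cong: "[x = y] (mod int p) \<Longrightarrow> twist p x = twist p y"
  unfolding twist_def using Legendre_cong cong_diff cong_refl by metis

text \<open>If \<open>p\<close> is 2 modulo 3, the values \<open>p - 1\<close> and \<open>-1\<close>
  are both nonzero modulo 3. If \<open>p\<close> is 1 modulo 3, the second translate changes them to
  \<open>p - 2\<close> and \<open>-2\<close>, since \<open>p\<close> cannot divide both
  \<open>e\<close> and \<open>e - 1\<close>.\<close>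

lemma sum_Legendre_twist:
  assumes p: "prime p" "3 < p"
  shows "\<not> 3 dvd (\<Sum>y<p. Legendre (int y) (int p) * twist p (e + int y))"
proof -
  have p2: "2 < p" using p by simp
  have "\<not> 3 dvd p" using p primes_dvd_imp_eq[of 3 p] by auto
  define J where "J m = (\<Sum>y<p. Legendre (int y) (int p) * Legendre (int y + m) (int p))" for m
  have J: "J m = (if int p dvd m then int p - 1 else -1)" for m
    unfolding J_def using sum_Legendre_shift[OF p(1) p2] .
  have "(\<Sum>y<p. Legendre (int y) (int p) * twist p (e + int y)) =
      J e + (if p mod 3 = 1 then J (e - 1) else 0)"
    by (simp add: twist_def J_def distrib_left sum.distrib algebra_simps)
  moreover have "\<not> 3 dvd J e + (if p mod 3 = 1 then J (e - 1) else 0)"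
  proof (cases "p mod 3 = 1")
    case True
    have "\<not> (int p dvd e \<and> int p dvd e - 1)"
    proof
      assume "int p dvd e \<and> int p dvd e - 1"
      then have "int p dvd e - (e - 1)" using dvd_diff by blast
      then show False using p2 by simp
    qed
    moreover have "\<not> 3 dvd int p - 2" using True by presburger
    ultimately show ?thesis unfolding J using True by auto
  next
    case False
    then have "\<not> 3 dvd int p - 1" using \<open>\<not> 3 dvd p\<close> by presburger
    then show ?thesis unfolding J using False by auto
  qed
  ultimately show ?thesis by simp
qed

text \<open>
  Each shift acts modulo \<open>p\<close> with one fixed point \<open>x0\<close> and one cycle of length \<open>p - 1\<close>. The fibre
  over \<open>x0\<close> carries a transposition; going once around the long cycle translates the residue modulo
  \<open>3\<close> by an alternating sum in which the shift cancels because \<open>p - 1\<close> is even.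
\<close>
lemma shifts_crt_le_three_cycles:
  fixes c :: "int \<Rightarrow> int"
  assumes p: "prime p" "3 < p" and g: "residue_primroot p g"
    and c: "\<And>x y. [x = y] (mod int p) \<Longrightarrow> c x = c y"
    and nz: "\<And>e. \<not> 3 dvd (\<Sum>k<p - 1. (-1) ^ k * c (e + int g ^ k))"
  shows "\<exists>\<pi>. \<pi> permutes {..<3 * p} \<and> (\<forall>b<3 * p. cyc (3 * p) (shiftp (3 * p) \<pi> b) \<le> 3)"
proof -
  have "\<not> 3 dvd p" using p primes_dvd_imp_eq[of 3 p] by auto
  then have cop3: "coprime 3 (int p)"
    using prime_imp_coprime[of 3 "int p"] by (simp add: int_dvd_int_iff[of 3, simplified])
  have copg: "coprime (int g) (int p)" using g by (simp add: residue_primroot_def coprime_commute)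
  have crt: "\<exists>z<3 * p. [int z = u] (mod 3) \<and> [int z = v] (mod int p)" for u v
  proof -
    obtain w where w: "[w = u] (mod 3)" "[w = v] (mod int p)"
      using binary_chinese_remainder_int[OF cop3] by blast
    define z where "z = nat (w mod (3 * int p))"
    have "int z = w mod (3 * int p)" using p by (simp add: z_def)
    then have "[int z = w] (mod 3 * int p)" by simp
    then have "[int z = w] (mod 3)" "[int z = w] (mod int p)"
      using cong_dvd_modulus by (metis dvd_triv_left, metis dvd_triv_right)
    moreover have "z < 3 * p" using p by (simp add: z_def nat_less_iff)
    ultimately show ?thesis using w cong_trans by blast
  qed
  have uniq: "x = y"
    if "x < 3 * p" "y < 3 * p" "[int x = int y] (mod 3)" "[int x = int y] (mod int p)" for x y
  proof -
    have "[int x = int y] (mod 3 * int p)" using that(3,4) cop3 by (rule coprime_cong_mult)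
    then have "[x = y] (mod 3 * p)" by (simp flip: cong_int_iff)
    then show ?thesis using that(1,2) by (simp add: cong_less_modulus_unique_nat)
  qed
  \<comment> \<open>The Chinese remainder theorem realises the map
    \<open>(u, x) -> (c x - u, g x)\<close> on single residues modulo \<open>3 * p\<close>.\<close>
  have "\<forall>x. \<exists>z<3 * p. [int z = c (int x) - int x] (mod 3) \<and> [int z = int g * int x] (mod int p)"
    using crt by blast
  then obtain F where F: "\<And>x. F x < 3 * p" "\<And>x. [int (F x) = c (int x) - int x] (mod 3)"
      "\<And>x. [int (F x) = int g * int x] (mod int p)"
    by metis
  define \<pi> where "\<pi> x = (if x < 3 * p then F x else x)" for x
  have \<pi>: "\<pi> permutes {..<3 * p}"
  proof (rule bij_imp_permutes)
    have "inj_on \<pi> {..<3 * p}"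
    proof (rule inj_onI)
      fix x y assume xy: "x \<in> {..<3 * p}" "y \<in> {..<3 * p}" "\<pi> x = \<pi> y"
      then have eq: "F x = F y" by (simp add: \<pi>_def)
      have "[int g * int x = int g * int y] (mod int p)"
        using F(3)[of x] F(3)[of y] unfolding eq by (metis cong_sym cong_trans)
      then have *: "[int x = int y] (mod int p)" using copg by (simp add: cong_mult_lcancel)
      have "[c (int x) - int x = c (int y) - int y] (mod 3)"
        using F(2)[of x] F(2)[of y] unfolding eq by (metis cong_sym cong_trans)
      then have "[int x = int y] (mod 3)" using c[OF *] by (simp add: cong_iff_dvd_diff dvd_diff_commute)
      then show "x = y" using uniq * xy by auto
    qed
    moreover have "\<pi> ` {..<3 * p} \<subseteq> {..<3 * p}" using F(1) by (auto simp: \<pi>_def)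
    ultimately show "bij_betw \<pi> {..<3 * p} {..<3 * p}" by (simp add: bij_betw_def endo_inj_surj)
  qed (simp add: \<pi>_def)
  have "cyc (3 * p) (shiftp (3 * p) \<pi> b) \<le> 3" for b
  proof -
    define \<sigma> where "\<sigma> = shiftp (3 * p) \<pi> b"
    have \<sigma>: "\<sigma> permutes {..<3 * p}" unfolding \<sigma>_def by (rule shiftp_permutes) fact
    have \<sigma>_less: "(\<sigma> ^^ k) x < 3 * p" if "x < 3 * p" for x k
      using permutes_in_image[OF permutes_funpow[OF \<sigma>], of k x] that by simp
    have step: "[int (\<sigma> x) = c (int x + int b) - (int x + int b)] (mod 3)"
        "[int (\<sigma> x) = int g * (int x + int b)] (mod int p)" if "x < 3 * p" for x
    proof -
      define y where "y = (x + b) mod (3 * p)"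
      have "\<sigma> x = F y" using that by (simp add: \<sigma>_def shiftp_def \<pi>_def y_def)
      have "[int y = int x + int b] (mod 3 * int p)" by (simp add: y_def zmod_int)
      then have y: "[int y = int x + int b] (mod 3)" "[int y = int x + int b] (mod int p)"
        using cong_dvd_modulus by (metis dvd_triv_left, metis dvd_triv_right)
      show "[int (\<sigma> x) = c (int x + int b) - (int x + int b)] (mod 3)"
        unfolding \<open>\<sigma> x = F y\<close> c[OF y(2), symmetric]
        using F(2)[of y] cong_diff[OF cong_refl y(1)] by (rule cong_trans)
      show "[int (\<sigma> x) = int g * (int x + int b)] (mod int p)"
        unfolding \<open>\<sigma> x = F y\<close>
        using F(3)[of y] cong_mult[OF cong_refl y(2)] by (rule cong_trans)
    qed
    \<comment> \<open>The order of \<open>g\<close> exceeds 1, so \<open>g - 1\<close> has an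
      inverse \<open>h\<close> modulo \<open>p\<close>, and solving \<open>g (x + b) = x\<close>
      yields \<open>x0\<close>.\<close>
    have "\<not> int p dvd int g - 1"
    proof
      assume "int p dvd int g - 1"
      then have "[int g = int 1] (mod int p)" by (simp add: cong_iff_dvd_diff)
      then have "[g ^ 1 = 1] (mod p)" by (simp only: cong_int_iff power_one_right)
      then have "ord p g dvd 1" by (rule iffD1[OF ord_divides])
      then show False using g p by (auto simp: residue_primroot_def totient_prime)
    qed
    then have "coprime (int g - 1) (int p)"
      using p prime_imp_coprime[of "int p" "int g - 1"] by (simp add: coprime_commute)
    then obtain h where h: "[(int g - 1) * h = 1] (mod int p)" using cong_solve_coprime_int by blast
    define x0 where "x0 = - (int g * int b * h)"
    have x0: "[int g * (x0 + int b) = x0] (mod int p)"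
    proof -
      have "int g * (x0 + int b) - x0 = int g * int b * (1 - (int g - 1) * h)"
        by (simp add: x0_def algebra_simps)
      then show ?thesis using h by (simp add: cong_iff_dvd_diff dvd_diff_commute)
    qed
    \<comment> \<open>Measured from its fixed point, the affine map is multiplication by
      \<open>g\<close>.\<close>
    have iter_p: "[int ((\<sigma> ^^ k) x) - x0 = int g ^ k * (int x - x0)] (mod int p)" if "x < 3 * p" for x k
    proof (induction k)
      case (Suc k)
      let ?w = "(\<sigma> ^^ k) x"
      have "[int (\<sigma> ?w) - x0 = int g * (int ?w + int b) - int g * (x0 + int b)] (mod int p)"
        using step(2)[OF \<sigma>_less[OF that]] cong_sym[OF x0] by (rule cong_diff)
      also have "int g * (int ?w + int b) - int g * (x0 + int b) = int g * (int ?w - x0)"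
        by (simp add: algebra_simps)
      also have "[int g * (int ?w - x0) = int g * (int g ^ k * (int x - x0))] (mod int p)"
        using Suc by (intro cong_mult cong_refl)
      finally show ?case by (simp add: mult.assoc)
    qed simp
    define e where "e = x0 + int b"
    define s where "s = (\<Sum>k<p - 1. (-1) ^ k * c (e + int g ^ k))"
    \<comment> \<open>Each step negates the residue modulo 3; the factor \<open>(-1) ^ k\<close>
      undoes this, so that increments add up. Starting over \<open>x0 + 1\<close> makes
      \<open>e + g ^ k\<close> the argument of \<open>c\<close> at step \<open>k\<close>.\<close>
    have iter_3: "[(-1) ^ k * int ((\<sigma> ^^ k) x) =
        int x + (\<Sum>i<k. (-1) ^ i * int b) - (\<Sum>i<k. (-1) ^ i * c (e + int g ^ i))] (mod 3)"
      if x: "x < 3 * p" "[int x - x0 = 1] (mod int p)" for x k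
    proof (induction k)
      case (Suc k)
      let ?w = "(\<sigma> ^^ k) x"
      have "[int ?w - x0 = int g ^ k * 1] (mod int p)"
        using iter_p[OF x(1), of k] cong_mult[OF cong_refl x(2)] by (rule cong_trans)
      then have "[int ?w + int b = e + int g ^ k] (mod int p)"
        by (simp add: cong_iff_dvd_diff e_def algebra_simps)
      then have "[int (\<sigma> ?w) = c (e + int g ^ k) - (int ?w + int b)] (mod 3)"
        using step(1)[OF \<sigma>_less[OF x(1)], of k] c by simp
      then have "[(-1) ^ Suc k * int (\<sigma> ?w) =
          (-1) ^ Suc k * (c (e + int g ^ k) - (int ?w + int b))] (mod 3)"
        by (intro cong_mult cong_refl)
      also have "(-1) ^ Suc k * (c (e + int g ^ k) - (int ?w + int b)) =
          (-1) ^ k * int ?w + ((-1) ^ k * int b - (-1) ^ k * c (e + int g ^ k))"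
        by (simp add: algebra_simps)
      also have "[\<dots> = (int x + (\<Sum>i<k. (-1) ^ i * int b) - (\<Sum>i<k. (-1) ^ i * c (e + int g ^ i)))
          + ((-1) ^ k * int b - (-1) ^ k * c (e + int g ^ k))] (mod 3)"
        using Suc by (intro cong_add cong_refl)
      finally show ?case by (simp add: algebra_simps)
    qed simp
    have "even (p - 1)" using p prime_odd_nat[of p] by simp
    then obtain m where m: "p - 1 = 2 * m" by blast
    have "(\<Sum>i<2 * m. (-1) ^ i * int b) = 0" for m by (induction m) simp_all
    then have alt: "(\<Sum>i<p - 1. (-1) ^ i * int b) = 0" unfolding m .
    \<comment> \<open>The return map to the fibre over \<open>x0 + 1\<close>, which is a translation
      by \<open>-s\<close> modulo 3.\<close>
    let ?\<tau> = "\<sigma> ^^ (p - 1)"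
    have \<tau>: "?\<tau> x < 3 * p" "[int (?\<tau> x) - x0 = 1] (mod int p)" "[int (?\<tau> x) = int x - s] (mod 3)"
      if x: "x < 3 * p" "[int x - x0 = 1] (mod int p)" for x
    proof -
      show "?\<tau> x < 3 * p" using \<sigma>_less x(1) .
      have "\<not> p dvd g" using copg p by (metis coprime_absorb_right coprime_int_iff not_prime_unit)
      then have "[int (g ^ (p - 1)) = int 1] (mod int p)"
        using fermat_theorem[OF p(1)] by (simp only: cong_int_iff)
      then have "[int g ^ (p - 1) * (int x - x0) = 1 * 1] (mod int p)"
        using x(2) by (intro cong_mult) simp_all
      with iter_p[OF x(1), of "p - 1"] show "[int (?\<tau> x) - x0 = 1] (mod int p)"
        by (simp add: cong_trans)
      show "[int (?\<tau> x) = int x - s] (mod 3)"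
        using iter_3[OF x, of "p - 1"] unfolding alt s_def unfolding m by simp
    qed
    obtain r where r: "r < 3 * p" "[int r = 0] (mod 3)" "[int r = x0 + 1] (mod int p)"
      using crt by blast
    \<comment> \<open>Over \<open>x0\<close> the residue modulo 3 is reflected by
      \<open>u -> C - u\<close>, which fixes \<open>-C\<close> and swaps \<open>1 - C\<close> with
      \<open>2 - C\<close>; \<open>r1\<close> and \<open>r2\<close> represent these two
      cycles.\<close>
    define C where "C = c e - int b"
    obtain r1 where r1: "r1 < 3 * p" "[int r1 = - C] (mod 3)" "[int r1 = x0] (mod int p)"
      using crt by blast
    obtain r2 where r2: "r2 < 3 * p" "[int r2 = 1 - C] (mod 3)" "[int r2 = x0] (mod int p)"
      using crt by blast
    have reach: "\<exists>k. (\<sigma> ^^ k) x \<in> {r, r1, r2}" if x: "x < 3 * p" for x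
    proof (cases "[int x = x0] (mod int p)")
      case True
      then have xb: "[int x + int b = e] (mod int p)" unfolding e_def by (intro cong_add cong_refl)
      have "[int g * (int x + int b) = int g * (x0 + int b)] (mod int p)"
        using xb unfolding e_def by (intro cong_mult cong_refl)
      then have \<sigma>p: "[int (\<sigma> x) = x0] (mod int p)"
        using step(2)[OF x] x0 cong_trans by blast
      have \<sigma>3: "[int (\<sigma> x) = C - int x] (mod 3)"
        using step(1)[OF x] c[OF xb] by (simp add: C_def algebra_simps)
      have "[int x = - C] (mod 3) \<or> [int x = 1 - C] (mod 3) \<or> [int x = 2 - C] (mod 3)"
        unfolding cong_iff_dvd_diff by presburger
      then consider "[int x = - C] (mod 3)" | "[int x = 1 - C] (mod 3)" | "[int x = 2 - C] (mod 3)"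
        by blast
      then show ?thesis
      proof cases
        case 1
        then have "x = r1" using x r1 True by (intro uniq) (auto intro: cong_trans cong_sym)
        then show ?thesis by (intro exI[of _ 0]) simp
      next
        case 2
        then have "x = r2" using x r2 True by (intro uniq) (auto intro: cong_trans cong_sym)
        then show ?thesis by (intro exI[of _ 0]) simp
      next
        case 3
        then have "[int (\<sigma> x) = int r2] (mod 3)"
          using \<sigma>3 r2(2) unfolding cong_iff_dvd_diff by presburger
        then have "\<sigma> x = r2" using \<sigma>_less[OF x, of 1] r2 \<sigma>p
          by (intro uniq) (auto intro: cong_trans cong_sym)
        then show ?thesis by (intro exI[of _ 1]) simp
      qed
    next
      case False
      then have "coprime (int x - x0) (int p)"
        using p prime_imp_coprime[of "int p" "int x - x0"] by (simp add: coprime_commute cong_iff_dvd_diff)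
      \<comment> \<open>The inverse \<open>d\<close> of \<open>x - x0\<close> is a power of
        \<open>g\<close>, so some iterate of \<open>x\<close> lies over
        \<open>x0 + 1\<close>.\<close>
      then obtain d where d: "[(int x - x0) * d = 1] (mod int p)" using cong_solve_coprime_int by blast
      define d' where "d' = nat (d mod int p)"
      have d': "int d' = d mod int p" using p by (simp add: d'_def)
      have "d' \<in> totatives p"
      proof -
        have "\<not> int p dvd d"
        proof
          assume "int p dvd d"
          then have "[(int x - x0) * d = 0] (mod int p)" by (simp add: cong_0_iff)
          then have "[1 = 0] (mod int p)" using d cong_sym cong_trans by blast
          then show False using p by (simp add: cong_def)
        qed
        then have "d' \<noteq> 0" using d' by (metis dvd_eq_mod_eq_0 of_nat_0)
        moreover have "d' < p" using p by (simp add: d'_def nat_less_iff)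
        ultimately show ?thesis using p by (auto simp: totatives_prime)
      qed
      then obtain k where "d' = g ^ k mod p"
        using residue_primroot_is_generator[OF _ g] p by (auto simp: bij_betw_def)
      then have "[int g ^ k = d] (mod int p)" using d' by (simp add: cong_def zmod_int)
      then have "[int g ^ k * (int x - x0) = d * (int x - x0)] (mod int p)" by (intro cong_mult cong_refl)
      then have y: "[int ((\<sigma> ^^ k) x) - x0 = 1] (mod int p)"
        using iter_p[OF x, of k] d by (simp add: mult.commute) (metis cong_trans)
      have fin: "z = r" if "z < 3 * p" "[int z - x0 = 1] (mod int p)" "3 dvd int z" for z
      proof (rule uniq)
        show "[int z = int r] (mod 3)" using that(3) r(2) by (simp add: cong_def dvd_eq_mod_eq_0)
        have "[int z = x0 + 1] (mod int p)" using that(2) by (simp add: cong_iff_dvd_diff algebra_simps)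
        then show "[int z = int r] (mod int p)" using r(3) cong_sym cong_trans by blast
      qed fact+
      define y where "y = (\<sigma> ^^ k) x"
      have y: "y < 3 * p" "[int y - x0 = 1] (mod int p)" using \<sigma>_less[OF x] y by (auto simp: y_def)
      note y1 = \<tau>[OF y] and y2 = \<tau>[OF \<tau>(1,2)[OF y]]
      \<comment> \<open>A nonzero translation modulo 3 reaches residue 0 within two turns, so
        \<open>r\<close> alone represents everything outside the fibre over
        \<open>x0\<close>.\<close>
      have "\<not> 3 dvd s" unfolding s_def by (rule nz)
      then have "3 dvd int y \<or> 3 dvd int (?\<tau> y) \<or> 3 dvd int (?\<tau> (?\<tau> y))"
        using y1(3) y2(3) unfolding cong_iff_dvd_diff by presburger
      then have "y = r \<or> ?\<tau> y = r \<or> ?\<tau> (?\<tau> y) = r"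
        using fin y y1 y2 by blast
      moreover have "?\<tau> y = (\<sigma> ^^ (p - 1 + k)) x" "?\<tau> (?\<tau> y) = (\<sigma> ^^ (p - 1 + (p - 1 + k))) x"
        unfolding y_def funpow_add by simp_all
      ultimately show ?thesis unfolding y_def by (metis insertI1)
    qed
    have "cyc (3 * p) \<sigma> \<le> card {r, r1, r2}"
      using \<sigma> _ reach by (rule cyc_le_card) simp
    also have "\<dots> \<le> 3" by (simp add: card_insert_if)
    finally show ?thesis unfolding \<sigma>_def .
  qed
  with \<pi> show ?thesis by blast
qed

theorem corollary1p5:
  fixes p :: nat
  assumes "prime p"
  shows "tmax (3 * p) = 3 * p - 3"
proof -
  have "p > 1" using assms by (rule prime_gt_1_nat)
  have "\<exists>\<pi>. \<pi> permutes {..<3 * p} \<and> (\<forall>b<3 * p. cyc (3 * p) (shiftp (3 * p) \<pi> b) \<le> 3)"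
  proof (cases "p > 3")
    case True
    obtain g where g: "residue_primroot p g"
      using prime_primitive_root_exists[of p] assms \<open>p > 1\<close> by auto
    show ?thesis
    proof (rule shifts_crt_le_three_cycles[OF assms True g twist_cong])
      fix e
      have "2 < p" using True by simp
      then show "\<not> 3 dvd (\<Sum>k<p - 1. (-1) ^ k * twist p (e + int g ^ k))"
        using sum_Legendre_twist[OF assms True, of e]
        by (subst sum_primroot_powers[OF assms _ g twist_cong])
    qed
  next
    case False
    then have "p = 2 \<or> p = 3" using \<open>p > 1\<close> by auto
    then show ?thesis
      using shifts_mod_6_le_three_cycles shifts_mod_9_le_three_cycles by auto
  qed
  then obtain \<pi> where "\<pi> permutes {..<3 * p}"
      "\<And>b. b < 3 * p \<Longrightarrow> cyc (3 * p) (shiftp (3 * p) \<pi> b) \<le> 3"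
    by blast
  with exists_shift_three_cycles[of _ "3 * p"] \<open>p > 1\<close> show ?thesis
    by (intro tmax_eqI) auto
qed

end
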